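(* Let $(\mathcal{H}, * )$ be a right zero semigroup or a left zero semigroup. Then every subsemigroup $\mathcal{S}$ of $(\mathcal{H}, * )$ admits a $d$-transitive monomorphism $\mathcal{S} \to \mathcal{B}_X$ for a suitable set $X$.
   Context: A semigroup (nonempty set with associative operation) $(\mathcal{H}, * )$ is a right zero semigroup if $x * y = y$ for all $x, y \in \mathcal{H}$, and a left zero semigroup if $x*y = x$ for all $x,y \in \mathcal{H}$. A subsemigroup is a nonempty subset closed under $*$. A zero of a semigroup is an element $\theta$ with $\theta * s = s * \theta = \theta$ for all $s$; by convention a semigroup must have at least two elements to possess a zero. $\mathcal{B}_X$ is the semigroup of all binary relations on $X$ (subsets of $X^2$) under composition: $\langle x,y\rangle \in \psi \circ \gamma$ iff there is $z \in X$ with $\langle x,z\rangle \in \psi$ and $\langle z,y\rangle \in \gamma$. A monomorphism is an injective homomorphism. A partition of a nonempty set is a set of nonempty pairwise disjoint subsets whose union is the whole set. A set $A \subseteq \mathcal{S}$ is a set of generators of $\mathcal{S}$ if every $s\in\mathcal{S}$ is a product $s_1 * \dots * s_k$ of a finite sequence of elements of $A$. A monomorphism $\Phi : \mathcal{S} \to \mathcal{B}_X$ is $d$-transitive if there is a set $A$ of generators of $(\mathcal{S}, * )$ such that $\{\Phi(a) : a \in A\}$ is a partition of $X^2$ and, if $\mathcal{S}$ contains a zero element $\theta$, then $\Phi(\theta) = \varnothing$. *)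

theory Defs
  imports Main "HOL-Library.Disjoint_Sets"
begin

definition semigroup_on :: "'a set \<Rightarrow> ('a \<Rightarrow> 'a \<Rightarrow> 'a) \<Rightarrow> bool" where
  "semigroup_on S f \<longleftrightarrow>
     S \<noteq> {} \<and>
     (\<forall>x\<in>S. \<forall>y\<in>S. f x y \<in> S) \<and>
     (\<forall>x\<in>S. \<forall>y\<in>S. \<forall>z\<in>S. f (f x y) z = f x (f y z))"

definition right_zero_semigroup :: "'a set \<Rightarrow> ('a \<Rightarrow> 'a \<Rightarrow> 'a) \<Rightarrow> bool" where
  "right_zero_semigroup S f \<longleftrightarrow> semigroup_on S f \<and> (\<forall>x\<in>S. \<forall>y\<in>S. f x y = y)"

definition left_zero_semigroup :: "'a set \<Rightarrow> ('a \<Rightarrow> 'a \<Rightarrow> 'a) \<Rightarrow> bool" where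
  "left_zero_semigroup S f \<longleftrightarrow> semigroup_on S f \<and> (\<forall>x\<in>S. \<forall>y\<in>S. f x y = x)"

definition subsemigroup :: "'a set \<Rightarrow> 'a set \<Rightarrow> ('a \<Rightarrow> 'a \<Rightarrow> 'a) \<Rightarrow> bool" where
  "subsemigroup S H f \<longleftrightarrow> S \<subseteq> H \<and> S \<noteq> {} \<and> (\<forall>x\<in>S. \<forall>y\<in>S. f x y \<in> S)"

text \<open>By convention a one-element semigroup has no zero.\<close>

definition is_zero :: "'a set \<Rightarrow> ('a \<Rightarrow> 'a \<Rightarrow> 'a) \<Rightarrow> 'a \<Rightarrow> bool" where
  "is_zero S f \<theta> \<longleftrightarrow>
     \<theta> \<in> S \<and> (\<exists>s\<in>S. s \<noteq> \<theta>) \<and> (\<forall>s\<in>S. f \<theta> s = \<theta> \<and> f s \<theta> = \<theta>)"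

text \<open>The product of the nonempty sequence \<open>a # as\<close> is \<open>foldl f a as\<close>.\<close>

definition generators :: "'a set \<Rightarrow> 'a set \<Rightarrow> ('a \<Rightarrow> 'a \<Rightarrow> 'a) \<Rightarrow> bool" where
  "generators A S f \<longleftrightarrow>
     A \<subseteq> S \<and> (\<forall>s\<in>S. \<exists>a as. a \<in> A \<and> set as \<subseteq> A \<and> s = foldl f a as)"

definition semigroup_monomorphism ::
  "('a \<Rightarrow> 'b) \<Rightarrow> 'a set \<Rightarrow> ('a \<Rightarrow> 'a \<Rightarrow> 'a) \<Rightarrow> 'b set \<Rightarrow> ('b \<Rightarrow> 'b \<Rightarrow> 'b) \<Rightarrow> bool" where
  "semigroup_monomorphism \<Phi> S f T g \<longleftrightarrow>
     \<Phi> ` S \<subseteq> T \<and> (\<forall>x\<in>S. \<forall>y\<in>S. \<Phi> (f x y) = g (\<Phi> x) (\<Phi> y)) \<and> inj_on \<Phi> S"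

text \<open>The semigroup of all binary relations on \<open>X\<close> is \<open>binrels X\<close> under \<open>(O)\<close>; in
  \<open>\<psi> O \<gamma>\<close> the relation \<open>\<psi>\<close> is applied first.\<close>

definition binrels :: "'x set \<Rightarrow> 'x rel set" where
  "binrels X = Pow (X \<times> X)"

text \<open>Only nonempty sets have partitions, whereas \<open>partition_on {} {}\<close> holds; hence the
  explicit \<open>X \<noteq> {}\<close>.\<close>

definition d_transitive_mono ::
  "('a \<Rightarrow> 'x rel) \<Rightarrow> 'a set \<Rightarrow> ('a \<Rightarrow> 'a \<Rightarrow> 'a) \<Rightarrow> 'x set \<Rightarrow> bool" where
  "d_transitive_mono \<Phi> S f X \<longleftrightarrow>
     semigroup_monomorphism \<Phi> S f (binrels X) (O) \<and>
     (\<exists>A. generators A S f \<and> X \<noteq> {} \<and> partition_on (X \<times> X) (\<Phi> ` A)) \<and>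
     (\<forall>\<theta>. is_zero S f \<theta> \<longrightarrow> \<Phi> \<theta> = {})"

end

theory Submission
  imports Defs
begin

text \<open>Take \<open>X = S\<close> and send \<open>s\<close> to the constant map \<open>S \<times> {s}\<close> (right zero) or to its
  converse \<open>{s} \<times> S\<close> (left zero). All of \<open>S\<close> serves as the set of generators, and there
  is no zero, since \<open>\<theta> * s\<close> and \<open>s * \<theta>\<close> differ for \<open>s \<noteq> \<theta>\<close>.\<close>

lemma generators_self: "generators S S f"
proof -
  have "\<exists>a as. a \<in> S \<and> set as \<subseteq> S \<and> s = foldl f a as" if "s \<in> S" for s
    \<comment> \<open>The one-term product: \<open>foldl f s [] = s\<close>.\<close>
    using that by (intro exI[of _ s] exI[of _ "[]"]) simp
  then show ?thesis
    by (simp add: generators_def)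
qed

text \<open>Distinct columns differ in the second coordinate, hence are disjoint;
  \<open>X \<noteq> {}\<close> keeps each block nonempty, as \<open>partition_on\<close>
  demands.\<close>

lemma partition_on_columns: "X \<noteq> {} \<Longrightarrow> partition_on (X \<times> Y) ((\<lambda>y. X \<times> {y}) ` Y)"
  by (auto simp: partition_on_def disjoint_def)

lemma partition_on_rows: "Y \<noteq> {} \<Longrightarrow> partition_on (X \<times> Y) ((\<lambda>x. {x} \<times> Y) ` X)"
  by (auto simp: partition_on_def disjoint_def)

lemma right_zero_d_transitive_mono:
  assumes "S \<noteq> {}" and f: "\<And>x y. x \<in> S \<Longrightarrow> y \<in> S \<Longrightarrow> f x y = y"
  shows "d_transitive_mono (\<lambda>s. S \<times> {s}) S f S"
proof -
  have "semigroup_monomorphism (\<lambda>s. S \<times> {s}) S f (binrels S) (O)"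
    \<comment> \<open>For \<open>s\<close>, \<open>t\<close> in \<open>S\<close>, the point
      \<open>s\<close> links every \<open>x\<close> to \<open>t\<close>, so
      \<open>(S \<times> {s}) O (S \<times> {t}) = S \<times> {t}\<close>, the image of
      \<open>f s t = t\<close>.\<close>
    using f by (auto simp: semigroup_monomorphism_def binrels_def inj_on_def)
  moreover have "\<not> is_zero S f \<theta>" for \<theta>
    using f by (auto simp: is_zero_def)
  ultimately show ?thesis
    using assms(1) generators_self[of S f] partition_on_columns[OF assms(1), of S]
    unfolding d_transitive_mono_def by simp (rule exI[of _ S], simp)
qed

lemma left_zero_d_transitive_mono:
  assumes "S \<noteq> {}" and f: "\<And>x y. x \<in> S \<Longrightarrow> y \<in> S \<Longrightarrow> f x y = x"
  shows "d_transitive_mono (\<lambda>s. {s} \<times> S) S f S"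
proof -
  have "semigroup_monomorphism (\<lambda>s. {s} \<times> S) S f (binrels S) (O)"
    \<comment> \<open>Dually, \<open>({s} \<times> S) O ({t} \<times> S) = {s} \<times> S\<close>,
      with \<open>t\<close> as the intermediate point.\<close>
    using f by (auto simp: semigroup_monomorphism_def binrels_def inj_on_def)
  moreover have "\<not> is_zero S f \<theta>" for \<theta>
    using f by (auto simp: is_zero_def)
  ultimately show ?thesis
    using assms(1) generators_self[of S f] partition_on_rows[OF assms(1), of S]
    unfolding d_transitive_mono_def by simp (rule exI[of _ S], simp)
qed

theorem proposition3p11:
  fixes H S :: "'a set" and f :: "'a \<Rightarrow> 'a \<Rightarrow> 'a"
  assumes "right_zero_semigroup H f \<or> left_zero_semigroup H f"
    and "subsemigroup S H f"
  shows "\<exists>(X :: 'a set) \<Phi>. d_transitive_mono \<Phi> S f X"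
proof -
  have S: "S \<noteq> {}" "S \<subseteq> H"
    using assms(2) by (auto simp: subsemigroup_def)
  from assms(1) show ?thesis
  proof
    assume "right_zero_semigroup H f"
    then have "f x y = y" if "x \<in> S" "y \<in> S" for x y
      using that S(2) by (auto simp: right_zero_semigroup_def)
    then show ?thesis
      using right_zero_d_transitive_mono[OF S(1)] by blast
  next
    assume "left_zero_semigroup H f"
    then have "f x y = x" if "x \<in> S" "y \<in> S" for x y
      using that S(2) by (auto simp: left_zero_semigroup_def)
    then show ?thesis
      using left_zero_d_transitive_mono[OF S(1)] by blast
  qed
qed

end
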